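(* Let $J,L,D,R_s,R_l,R_L>0$ be constants, $R=R_s+R_l+R_L$, and let $b,I,\omega^s,T_m\in\mathbb{R}$ be constants. Let $(\delta^s,\omega^s,i_d^s,i_q^s)\in\mathbb{R}^4$ satisfy the equilibrium equations $$\begin{aligned}0&=-D\omega^s-b\,i_q^s+T_m,\\ 0&=-R\,i_d^s-L\omega^si_q^s-R_LI\sin\delta^s,\\ 0&=-R\,i_q^s+L\omega^si_d^s+b\,\omega^s-R_LI\cos\delta^s.\end{aligned}$$ Consider the shifted synchronous machine system with state $\tilde x=(\tilde\delta,\tilde\omega,\tilde i_d,\tilde i_q)\in\mathbb{R}^4$, $$\begin{aligned}\dot{\tilde\delta}&=-\tilde\omega,\\ J\dot{\tilde\omega}&=-D\tilde\omega-b\,\tilde i_q,\\ L\,\dot{\tilde i}_d&=-R\,\tilde i_d-L\tilde\omega\tilde i_q-L\tilde\omega i_q^s-L\omega^s\tilde i_q-R_LI\big(\sin(\tilde\delta+\delta^s)-\sin\delta^s\big),\\ L\,\dot{\tilde i}_q&=-R\,\tilde i_q+L\tilde\omega\tilde i_d+L\tilde\omega i_d^s+L\omega^s\tilde i_d+b\,\tilde\omega-R_LI\big(\cos(\tilde\delta+\delta^s)-\cos\delta^s\big),\end{aligned}$$ with shifted input and output $$\tilde u_1=\begin{bmatrix}I(\sin(\tilde\delta+\delta^s)-\sin\delta^s)\\ I(\cos(\tilde\delta+\delta^s)-\cos\delta^s)\end{bmatrix},\qquad \tilde y_1=R_L\begin{bmatrix}I(\sin(\tilde\delta+\delta^s)-\sin\delta^s)+\tilde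 i_d\\ I(\cos(\tilde\delta+\delta^s)-\cos\delta^s)+\tilde i_q\end{bmatrix}.$$ If $$(i_d^s)^2+(i_q^s)^2\le\frac{4D(R_s+R_l)}{L^2},$$ then the shifted system is passive from $\tilde u_1$ to $\tilde y_1$. Moreover, if this inequality is strict, then the shifted system is (output) strictly passive from $\tilde u_1$ to $\tilde y_1$.
   Context: The shifted system is obtained from the synchronous machine model $\dot\delta=\omega^s-\omega$, $J\dot\omega=-D\omega-bi_q+T_m$, $L\dot i_d=-Ri_d-L\omega i_q-R_LI\sin\delta$, $L\dot i_q=-Ri_q+L\omega i_d+b\omega-R_LI\cos\delta$ (with $\delta=\omega^st-\theta$, $\dot\theta=\omega$, $\theta$ the rotor angle) by the substitution $\delta=\tilde\delta+\delta^s$, $\omega=\tilde\omega+\omega^s$, $i_d=\tilde i_d+i_d^s$, $i_q=\tilde i_q+i_q^s$ and the equilibrium equations, with constant mechanical torque $T_m$. Passivity: a system with state $x\in\mathbb{R}^n$, input $u$, output $y$ (with equilibrium at the origin) is passive if there is a continuously differentiable storage function $V:\mathbb{R}^n\to\mathbb{R}_{\ge0}$ with $V(0)=0$ and $\dot V(x)\le y^\top u$ along all trajectories. It is output strictly passive if there are such a $V$ and a constant $\rho>0$ with $\dot V(x)\le y^\top u-\rho\,y^\top y$ along all trajectories. *)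

theory Defs
  imports "HOL-Analysis.Analysis"
begin

definition continuously_differentiable ::
  "('a::real_normed_vector \<Rightarrow> 'b::real_normed_vector) \<Rightarrow> bool" where
  "continuously_differentiable V \<longleftrightarrow>
     (\<exists>V'. (\<forall>x. (V has_derivative blinfun_apply (V' x)) (at x)) \<and> continuous_on UNIV V')"

(* A system is a relation between the state, the time derivative of the state, the input and
   the output.  This covers x' = f(x,u), y = h(x,u), systems whose input and output are both
   functions of the state, and equations such as J * x' = ... left unsolved for x'. *)
type_synonym ('x, 'u, 'y) io_system = "'x \<Rightarrow> 'x \<Rightarrow> 'u \<Rightarrow> 'y \<Rightarrow> bool"

(* T may be any nondegenerate interval; at an endpoint belonging to T the derivative is
   one-sided. *)
definition trajectory ::
  "('x::real_normed_vector, 'u, 'y) io_system \<Rightarrow> real set \<Rightarrow>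
     (real \<Rightarrow> 'x) \<Rightarrow> (real \<Rightarrow> 'u) \<Rightarrow> (real \<Rightarrow> 'y) \<Rightarrow> bool" where
  "trajectory S T x u y \<longleftrightarrow>
     is_interval T \<and> interior T \<noteq> {} \<and>
     (\<forall>t\<in>T. \<exists>x'. (x has_vector_derivative x') (at t within T) \<and> S (x t) x' (u t) (y t))"

(* Dissipation with respect to a supply rate s; the conjunct S 0 0 0 0 is the standing
   requirement that the origin is an equilibrium (for zero input, with zero output). *)
definition dissipative ::
  "('x::real_normed_vector, 'u::real_inner, 'u) io_system \<Rightarrow> ('u \<Rightarrow> 'u \<Rightarrow> real) \<Rightarrow> bool" where
  "dissipative S s \<longleftrightarrow>
     S 0 0 0 0 \<and>
     (\<exists>V :: 'x \<Rightarrow> real. continuously_differentiable V \<and> (\<forall>x. 0 \<le> V x) \<and> V 0 = 0 \<and>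
        (\<forall>T x u y. trajectory S T x u y \<longrightarrow>
           (\<forall>t\<in>T. \<exists>d. ((\<lambda>\<tau>. V (x \<tau>)) has_real_derivative d) (at t within T) \<and>
                     d \<le> s (u t) (y t))))"

definition passive_system :: "('x::real_normed_vector, 'u::real_inner, 'u) io_system \<Rightarrow> bool" where
  "passive_system S \<longleftrightarrow> dissipative S (\<lambda>u y. y \<bullet> u)"

definition output_strictly_passive_system ::
  "('x::real_normed_vector, 'u::real_inner, 'u) io_system \<Rightarrow> bool" where
  "output_strictly_passive_system S \<longleftrightarrow> (\<exists>\<rho>>0. dissipative S (\<lambda>u y. y \<bullet> u - \<rho> * (y \<bullet> y)))"

(* Components of the state x are the shifted angle, speed, d-current and q-current. *)
definition shifted_machine ::
  "real \<Rightarrow> real \<Rightarrow> real \<Rightarrow> real \<Rightarrow> real \<Rightarrow> real \<Rightarrow> real \<Rightarrow> real \<Rightarrow> real \<Rightarrow> real \<Rightarrow> real \<Rightarrow> real \<Rightarrow>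
     (real^4, real^2, real^2) io_system" where
  "shifted_machine J L D Rs Rl RL b I \<delta>s \<omega>s i_ds i_qs x x' u y \<longleftrightarrow>
     (let R = Rs + Rl + RL; \<delta> = x$1; \<omega> = x$2; i_d = x$3; i_q = x$4 in
        x'$1 = - \<omega> \<and>
        J * x'$2 = - D * \<omega> - b * i_q \<and>
        L * x'$3 = - R * i_d - L * \<omega> * i_q - L * \<omega> * i_qs - L * \<omega>s * i_q
                     - RL * I * (sin (\<delta> + \<delta>s) - sin \<delta>s) \<and>
        L * x'$4 = - R * i_q + L * \<omega> * i_d + L * \<omega> * i_ds + L * \<omega>s * i_d + b * \<omega>
                     - RL * I * (cos (\<delta> + \<delta>s) - cos \<delta>s) \<and>
        u = vector [I * (sin (\<delta> + \<delta>s) - sin \<delta>s), I * (cos (\<delta> + \<delta>s) - cos \<delta>s)] \<and>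
        y = RL *\<^sub>R vector [I * (sin (\<delta> + \<delta>s) - sin \<delta>s) + i_d,
                          I * (cos (\<delta> + \<delta>s) - cos \<delta>s) + i_q])"

end

theory Submission imports Defs begin

text \<open>The storage function is the kinetic plus magnetic energy
  \<open>V = (J \<omega>\<^sup>2 + L i\<^sub>d\<^sup>2 + L i\<^sub>q\<^sup>2) / 2\<close>, which ignores the angle. Along the shifted system
  the supplied power \<open>y \<bullet> u\<close> exceeds the derivative of \<open>V\<close> by
  \<open>D \<omega>\<^sup>2 + (R\<^sub>s + R\<^sub>l) \<bar>i\<bar>\<^sup>2 - L \<omega> (i\<^sub>d\<^sub>s i\<^sub>q - i\<^sub>q\<^sub>s i\<^sub>d) + R\<^sub>L \<bar>u + i\<bar>\<^sup>2\<close>. The condition on the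
  equilibrium currents makes the first three terms a nonnegative quadratic form, and the last term
  is \<open>\<bar>y\<bar>\<^sup>2 / R\<^sub>L\<close>. So even the non-strict condition gives output strict passivity with
  \<open>\<rho> = 1 / R\<^sub>L\<close>.\<close>

text \<open>The chain rule turns the derivative of \<open>V\<close> along a trajectory into
  \<open>g x \<bullet> x'\<close>, so dissipation reduces to an inequality at each point of the
  relation \<open>S\<close>, with no trajectories left.\<close>

lemma dissipativeI_gradient:
  fixes S :: "('x::real_inner, 'u::real_inner, 'u) io_system"
  assumes zero: "S 0 0 0 0"
    and deriv: "\<And>x. (V has_derivative (\<lambda>h. g x \<bullet> h)) (at x)"
    and cont: "continuous_on UNIV g"
    and nonneg: "\<And>x. 0 \<le> V x" and V0: "V 0 = 0"
    and ineq: "\<And>x x' u y. S x x' u y \<Longrightarrow> g x \<bullet> x' \<le> s u y"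
  shows "dissipative S s"
proof -
  have "continuous_on UNIV (\<lambda>x. blinfun_inner_right (g x))"
    by (rule bounded_linear.continuous_on[OF bounded_linear_blinfun_inner_right cont])
  with deriv have "continuously_differentiable V"
    unfolding continuously_differentiable_def
    by (intro exI[of _ "\<lambda>x. blinfun_inner_right (g x)"]) simp
  moreover have "\<exists>d. ((\<lambda>\<tau>. V (x \<tau>)) has_real_derivative d) (at t within T) \<and> d \<le> s (u t) (y t)"
    if traj: "trajectory S T x u y" and t: "t \<in> T" for T x u y t
  proof -
    obtain x' where x': "(x has_vector_derivative x') (at t within T)" "S (x t) x' (u t) (y t)"
      using traj t unfolding trajectory_def by blast
    \<comment> \<open>\<open>V\<close> is differentiable on the whole space, so the composition is
      differentiable within \<open>T\<close>, also at endpoints of \<open>T\<close>.\<close>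
    have "((\<lambda>\<tau>. V (x \<tau>)) has_derivative (\<lambda>h. g (x t) \<bullet> (h *\<^sub>R x'))) (at t within T)"
      using has_derivative_compose[OF x'(1)[unfolded has_vector_derivative_def] deriv] .
    then have "((\<lambda>\<tau>. V (x \<tau>)) has_real_derivative (g (x t) \<bullet> x')) (at t within T)"
      by (simp add: has_field_derivative_def mult_commute_abs)
    with ineq[OF x'(2)] show ?thesis by blast
  qed
  ultimately show ?thesis
    unfolding dissipative_def using zero nonneg V0 by blast
qed

lemma dissipative_mono:
  assumes "dissipative S s" and "\<And>u y. s u y \<le> s' u y"
  shows "dissipative S s'"
  using assms unfolding dissipative_def by (meson order_trans)

lemma output_strictly_passive_imp_passive:
  assumes "output_strictly_passive_system S"
  shows "passive_system S"
proof -
  obtain \<rho> where "\<rho> > 0" and diss: "dissipative S (\<lambda>u y. y \<bullet> u - \<rho> * (y \<bullet> y))"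
    using assms unfolding output_strictly_passive_system_def by blast
  show ?thesis
    unfolding passive_system_def
    by (rule dissipative_mono[OF diss]) (use \<open>\<rho> > 0\<close> in simp)
qed

text \<open>The difference of the two sides is a quadratic in \<open>w\<close> with leading
  coefficient \<open>D\<close>. The bound and Cauchy-Schwarz make its discriminant
  nonpositive.\<close>

lemma cross_term_le:
  fixes a b c d w D G L :: real
  assumes "D > 0" "G \<ge> 0" and bound: "L\<^sup>2 * (a\<^sup>2 + b\<^sup>2) \<le> 4 * D * G"
  shows "L * w * (a * d - b * c) \<le> D * w\<^sup>2 + G * (c\<^sup>2 + d\<^sup>2)"
proof -
  \<comment> \<open>Lagrange's identity, which yields Cauchy-Schwarz for \<open>(a, b)\<close> and
    \<open>(d, -c)\<close>.\<close>
  have "(a\<^sup>2 + b\<^sup>2) * (c\<^sup>2 + d\<^sup>2) - (a * d - b * c)\<^sup>2 = (a * c + b * d)\<^sup>2"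
    by (simp add: power2_eq_square algebra_simps)
  then have "(a * d - b * c)\<^sup>2 \<le> (a\<^sup>2 + b\<^sup>2) * (c\<^sup>2 + d\<^sup>2)"
    by (smt (verit) zero_le_power2)
  then have "L\<^sup>2 * (a * d - b * c)\<^sup>2 \<le> L\<^sup>2 * ((a\<^sup>2 + b\<^sup>2) * (c\<^sup>2 + d\<^sup>2))"
    by (rule mult_left_mono) simp
  also have "\<dots> \<le> 4 * D * G * (c\<^sup>2 + d\<^sup>2)"
    using mult_right_mono[OF bound, of "c\<^sup>2 + d\<^sup>2"] by (simp add: mult.assoc)
  \<comment> \<open>Completing the square in \<open>w\<close>: the sum is \<open>4 * D\<close> times
    the slack in the claim.\<close>
  finally have "0 \<le> (2 * D * w - L * (a * d - b * c))\<^sup>2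
      + (4 * D * G * (c\<^sup>2 + d\<^sup>2) - L\<^sup>2 * (a * d - b * c)\<^sup>2)"
    by simp
  also have "\<dots> = 4 * D * (D * w\<^sup>2 + G * (c\<^sup>2 + d\<^sup>2) - L * w * (a * d - b * c))"
    by (simp add: power2_eq_square algebra_simps)
  finally show ?thesis
    using \<open>D > 0\<close> by (simp add: zero_le_mult_iff)
qed

definition machine_energy :: "real \<Rightarrow> real \<Rightarrow> real^4 \<Rightarrow> real" where
  "machine_energy J L x = (J * (x$2)\<^sup>2 + L * (x$3)\<^sup>2 + L * (x$4)\<^sup>2) / 2"

definition machine_energy_gradient :: "real \<Rightarrow> real \<Rightarrow> real^4 \<Rightarrow> real^4" where
  "machine_energy_gradient J L x =
     (J * x$2) *\<^sub>R axis 2 1 + (L * x$3) *\<^sub>R axis 3 1 + (L * x$4) *\<^sub>R axis 4 1"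

lemma inner_machine_energy_gradient:
  "machine_energy_gradient J L x \<bullet> h = J * x$2 * h$2 + L * x$3 * h$3 + L * x$4 * h$4"
  by (simp add: machine_energy_gradient_def inner_add_left inner_axis')

lemma has_derivative_machine_energy:
  "(machine_energy J L has_derivative (\<lambda>h. machine_energy_gradient J L x \<bullet> h)) (at x)"
  unfolding machine_energy_def[abs_def] inner_machine_energy_gradient
  by (auto intro!: derivative_eq_intros bounded_linear.has_derivative[OF bounded_linear_vec_nth]
      simp: fun_eq_iff field_simps)

lemma continuous_on_machine_energy_gradient:
  "continuous_on UNIV (machine_energy_gradient J L)"
  unfolding machine_energy_gradient_def[abs_def] by (intro continuous_intros)

text \<open>The resistance is split: \<open>Rs + Rl\<close>, together with \<open>D\<close>, absorbs
  the cross term, while \<open>RL\<close> is kept to form the supply rate.\<close>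

lemma shifted_machine_dissipation:
  assumes "D > 0" "Rs + Rl \<ge> 0" "RL > 0"
    and bound: "L\<^sup>2 * (i_ds\<^sup>2 + i_qs\<^sup>2) \<le> 4 * D * (Rs + Rl)"
    and S: "shifted_machine J L D Rs Rl RL b I \<delta>s \<omega>s i_ds i_qs x x' u y"
  shows "machine_energy_gradient J L x \<bullet> x' \<le> y \<bullet> u - 1 / RL * (y \<bullet> y)"
proof -
  define w c d where "w = x$2" and "c = x$3" and "d = x$4"
  define p q where "p = I * (sin (x$1 + \<delta>s) - sin \<delta>s)" and "q = I * (cos (x$1 + \<delta>s) - cos \<delta>s)"
  note defs = w_def[symmetric] c_def[symmetric] d_def[symmetric] p_def[symmetric] q_def[symmetric]
  have eqs: "J * x'$2 = - D * w - b * d"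
      "L * x'$3 = - (Rs + Rl + RL) * c - L * w * d - L * w * i_qs - L * \<omega>s * d - RL * p"
      "L * x'$4 = - (Rs + Rl + RL) * d + L * w * c + L * w * i_ds + L * \<omega>s * c + b * w - RL * q"
    and u: "u = vector [p, q]" and y: "y = RL *\<^sub>R vector [p + c, q + d]"
    using S unfolding shifted_machine_def Let_def by (simp_all only: defs mult.assoc)
  have "machine_energy_gradient J L x \<bullet> x' = w * (J * x'$2) + c * (L * x'$3) + d * (L * x'$4)"
    by (simp add: inner_machine_energy_gradient defs)
  \<comment> \<open>The terms in \<open>b * w * d\<close>, \<open>L * w * c * d\<close> and
    \<open>L * \<omega>s * c * d\<close> cancel in pairs.\<close>
  also have "\<dots> = L * w * (i_ds * d - i_qs * c) - D * w\<^sup>2 - (Rs + Rl) * (c\<^sup>2 + d\<^sup>2)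
      - RL * (c\<^sup>2 + d\<^sup>2 + c * p + d * q)"
    unfolding eqs by (simp add: power2_eq_square algebra_simps)
  also have "\<dots> \<le> - RL * (c\<^sup>2 + d\<^sup>2 + c * p + d * q)"
    using cross_term_le[OF \<open>D > 0\<close> \<open>Rs + Rl \<ge> 0\<close> bound, of w d c] by simp
  \<comment> \<open>With \<open>i = (c, d)\<close>, \<open>y = RL (u + i)\<close> gives
    \<open>u - y / RL = -i\<close>, so both sides equal \<open>-(y \<bullet> i)\<close>.\<close>
  also have "\<dots> = y \<bullet> u - 1 / RL * (y \<bullet> y)"
    using \<open>RL > 0\<close> unfolding u y
    by (simp add: inner_vec_def sum_2 power2_eq_square field_simps)
  finally show ?thesis .
qed

lemma shifted_machine_zero: "shifted_machine J L D Rs Rl RL b I \<delta>s \<omega>s i_ds i_qs 0 0 0 0"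
  by (simp add: shifted_machine_def vec_eq_iff forall_2)

lemma shifted_machine_output_strictly_passive:
  assumes "J > 0" "L > 0" "D > 0" "Rs + Rl \<ge> 0" "RL > 0"
    and le: "i_ds\<^sup>2 + i_qs\<^sup>2 \<le> 4 * D * (Rs + Rl) / L\<^sup>2"
  shows "output_strictly_passive_system (shifted_machine J L D Rs Rl RL b I \<delta>s \<omega>s i_ds i_qs)"
proof -
  have bound: "L\<^sup>2 * (i_ds\<^sup>2 + i_qs\<^sup>2) \<le> 4 * D * (Rs + Rl)"
    using le \<open>L > 0\<close> by (simp add: field_simps)
  have "dissipative (shifted_machine J L D Rs Rl RL b I \<delta>s \<omega>s i_ds i_qs)
      (\<lambda>u y. y \<bullet> u - 1 / RL * (y \<bullet> y))"
  proof (rule dissipativeI_gradient[where V = "machine_energy J L"])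
    show "machine_energy J L x \<ge> 0" for x
      using \<open>J > 0\<close> \<open>L > 0\<close> by (simp add: machine_energy_def)
    show "machine_energy J L 0 = 0"
      by (simp add: machine_energy_def)
  qed (use has_derivative_machine_energy continuous_on_machine_energy_gradient
      shifted_machine_zero shifted_machine_dissipation[OF assms(3-5) bound] in auto)
  then show ?thesis
    unfolding output_strictly_passive_system_def using \<open>RL > 0\<close>
    by (intro exI[of _ "1 / RL"]) simp
qed

theorem theorem3:
  fixes J L D Rs Rl RL R b I \<omega>s Tm \<delta>s i_ds i_qs :: real
  assumes "J > 0" and "L > 0" and "D > 0" and "Rs > 0" and "Rl > 0" and "RL > 0"
    and "R = Rs + Rl + RL"
    and "0 = - D * \<omega>s - b * i_qs + Tm"
    and "0 = - R * i_ds - L * \<omega>s * i_qs - RL * I * sin \<delta>s"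
    and "0 = - R * i_qs + L * \<omega>s * i_ds + b * \<omega>s - RL * I * cos \<delta>s"
  shows "(i_ds\<^sup>2 + i_qs\<^sup>2 \<le> 4 * D * (Rs + Rl) / L\<^sup>2 \<longrightarrow>
            passive_system (shifted_machine J L D Rs Rl RL b I \<delta>s \<omega>s i_ds i_qs)) \<and>
         (i_ds\<^sup>2 + i_qs\<^sup>2 < 4 * D * (Rs + Rl) / L\<^sup>2 \<longrightarrow>
            output_strictly_passive_system (shifted_machine J L D Rs Rl RL b I \<delta>s \<omega>s i_ds i_qs))"
  \<comment> \<open>Both claims use the same result: the first weakens its conclusion to passivity,
    the second weakens the strict bound to a non-strict one.\<close>
  using shifted_machine_output_strictly_passive[of J L D Rs Rl RL i_ds i_qs]
    assms(1-6)
  by (auto intro: output_strictly_passive_imp_passive)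

end
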